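(* Suppose the following assumptions hold. (1) For each $z\in\mathcal Z$, $|c(z,\bar y)-c(z,y)|\le L(z)\|\bar y-y\|$ for all $y,\bar y\in\mathcal Y$, where $\sup_{z\in\mathcal Z}L(z)<+\infty$. (2) $\frac1n\sum_{i=1}^n\|Q^*(x^i)\|^4\xrightarrow{p}\mathbb E[\|Q^*(X)\|^4]$ and $\frac1n\sum_{i=1}^n\|[Q^*(x^i)]^{-1}\|^2\xrightarrow{p}\mathbb E[\|[Q^*(X)]^{-1}\|^2]$ (these expectations being finite). (3) $\frac1n\sum_{i=1}^n\|\varepsilon^i\|^4\xrightarrow{p}\mathbb E[\|\varepsilon\|^4]$ (this expectation being finite). (4) For a.e. $x\in\mathcal X$, $\sqrt n\,(g_n^*(\cdot;x)-g(\cdot;x))\xrightarrow{d}V(\cdot;x)$, where $g_n^*(\cdot;x)$, $g(\cdot;x)$ and $V(\cdot;x)$ are (random) elements of $\mathcal C(\mathcal Z)$, the Banach space of real-valued continuous functions on $\mathcal Z$ with the supremum norm. (5) There is a constant $0<\alpha\le1$, independent of $n$ (but possibly depending on $d_x$), such that: (a) $\|\hat f_n(x)-f^*(x)\|=O_p(n^{-\alpha/2})$ for a.e. $x\in\mathcal X$; (b) $\frac1n\sum_{i=1}^n\|\hat f_n(x^i)-f^*(x^i)\|^2=O_p(n^{-\alpha})$; (c) $\|\hat Q_n(x)-Q^*(x)\|=O_p(n^{-\alpha/2})$ for a.e. $x\in\mathcal X$; (d) $\frac1n\sum_{i=1}^n\|[\hat Q_n(x^i)]^{-1}-[Q^*(x^i)]^{-1}\|^2=O_p(n^{-\alpha})$.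 Then, for a.e. $x\in\mathcal X$, $$|\hat v_n^{ER}(x)-v^*(x)|=O_p(n^{-\alpha/2})\qquad\text{and}\qquad|g(\hat z_n^{ER}(x);x)-\hat v_n^{ER}(x)|=O_p(n^{-\alpha/2}).$$
   Context: Setting. $X$ is a random vector of covariates with distribution $P_X$ and support $\mathcal X\subseteq\mathbb R^{d_x}$; $Y$ is a random vector with (closed) support $\mathcal Y\subseteq\mathbb R^{d_y}$, which is assumed nonempty and convex. $\mathcal Z\subset\mathbb R^{d_z}$ is nonempty and compact and $c:\mathcal Z\times\mathcal Y\to\mathbb R$. It is assumed that $Y=f^*(X)+Q^*(X)\varepsilon$, where $f^*(x)=\mathbb E[Y\mid X=x]$, $Q^*(\bar x)\in\mathbb R^{d_y\times d_y}$ is positive definite for all $\bar x\in\mathcal X$, and $\varepsilon$ is a zero-mean random vector independent of $X$ with distribution $P_\varepsilon$ and support $\Xi\subseteq\mathbb R^{d_y}$. True problem: $v^*(x):=\min_{z\in\mathcal Z}\{g(z;x):=\mathbb E[c(z,f^*(x)+Q^*(x)\varepsilon)]\}$ (expectation over $\varepsilon\sim P_\varepsilon$). It is assumed that $\mathbb E[|c(z,f^*(x)+Q^*(x)\varepsilon)|]<+\infty$ for each $z\in\mathcal Z$ and a.e. $x\in\mathcal X$, and that $g(\cdot;x)$ is lower semicontinuous on $\mathcal Z$ for a.e. $x\in\mathcal X$. Data: $\mathcal D_n=\{(y^i,x^i)\}_{i=1}^n$ are joint observations of $(Y,X)$ (not assumed i.i.d. unless stated), and $\varepsilon^i:=[Q^*(x^i)]^{-1}(y^i-f^*(x^i))$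 are the corresponding error realizations. Full-information SAA objective: $g_n^*(z;x):=\frac1n\sum_{i=1}^n c(z,f^*(x)+Q^*(x)\varepsilon^i)$; for a.e. $x$, the points $f^*(x)+Q^*(x)\varepsilon^i$ lie in $\mathcal Y$ almost surely. Estimates: $\hat f_n:\mathcal X\to\mathbb R^{d_y}$ and $\hat Q_n:\mathcal X\to\mathbb R^{d_y\times d_y}$ (with $\hat Q_n(\bar x)$ nonsingular for all $\bar x\in\mathcal X$) are estimates of $f^*$ and $Q^*$ computed from $\mathcal D_n$. Empirical residuals: $\hat\varepsilon_n^i:=[\hat Q_n(x^i)]^{-1}(y^i-\hat f_n(x^i))$. With $\operatorname{proj}_{\mathcal Y}$ the orthogonal projection onto $\mathcal Y$, the empirical-residuals SAA (ER-SAA) problem is $$\hat v_n^{ER}(x):=\min_{z\in\mathcal Z}\Bigl\{\hat g_n^{ER}(z;x):=\frac1n\sum_{i=1}^n c\bigl(z,\operatorname{proj}_{\mathcal Y}(\hat f_n(x)+\hat Q_n(x)\hat\varepsilon_n^i)\bigr)\Bigr\}.$$ Its optimal solution set is assumed nonempty for a.e. $x\in\mathcal X$, and $\hat z_n^{ER}(x)$ denotes an optimal solution. Conventions: $\|\cdot\|$ is the Euclidean norm or its induced matrix norm; "a.e. $x\in\mathcal X$" is with respect to $P_X$; probabilities, $\xrightarrow{p}$ and $\xrightarrow{d}$ (convergence in probability and in distribution as $n\to\infty$) refer to the measure generating the data; all functions, sets and selections are assumed measurable. $V_n=O_p(a_n)$ means that $V_n/a_n$ is bounded in probability. *)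

theory Defs
  imports "HOL-Probability.Probability"
begin

text \<open>
  Conventions. Functions that the mathematics defines only on a closed set (\<open>c\<close> on
  \<open>\<Z> \<times> \<Y>\<close>, the regression functions and their estimates on \<open>\<X>\<close>) are represented by total
  functions; values outside that set are arbitrary, and the hypotheses only constrain values inside it.
  Measurability of such a function is stated for the total function, which is no restriction,
  since a Borel function on a closed set has a Borel extension.
\<close>

definition mnorm :: "real^'m^'n \<Rightarrow> real" where
  "mnorm A = onorm (\<lambda>v. A *v v)"

text \<open>Symmetry is not part of the definition; hypotheses of positive definiteness therefore cover
  both the symmetric and the general case.\<close>

definition pos_def :: "real^'n^'n \<Rightarrow> bool" where
  "pos_def A \<longleftrightarrow> (\<forall>v. v \<noteq> 0 \<longrightarrow> 0 < v \<bullet> (A *v v))"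

definition topological_support :: "'a::topological_space measure \<Rightarrow> 'a set" where
  "topological_support \<mu> = {x. \<forall>U. open U \<longrightarrow> x \<in> U \<longrightarrow> 0 < emeasure \<mu> U}"

definition lsc_on :: "'a::topological_space set \<Rightarrow> ('a \<Rightarrow> real) \<Rightarrow> bool" where
  "lsc_on S f \<longleftrightarrow> (\<forall>z\<in>S. \<forall>a < f z. \<forall>\<^sub>F w in at z within S. a < f w)"

definition cond_expectation_fun ::
  "'p measure \<Rightarrow> ('p \<Rightarrow> real^'m) \<Rightarrow> ('p \<Rightarrow> real^'k) \<Rightarrow> (real^'k \<Rightarrow> real^'m) \<Rightarrow> bool" where
  "cond_expectation_fun \<Omega> Y X f \<longleftrightarrow>
     integrable \<Omega> Y \<and> f \<in> borel_measurable borel \<and>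
     (\<forall>j. AE p in \<Omega>.
        f (X p) $ j = real_cond_exp \<Omega> (vimage_algebra (space \<Omega>) X borel) (\<lambda>p. Y p $ j) p)"

section \<open>Modes of convergence\<close>

definition conv_in_prob :: "'w measure \<Rightarrow> (nat \<Rightarrow> 'w \<Rightarrow> real) \<Rightarrow> real \<Rightarrow> bool" where
  "conv_in_prob M V l \<longleftrightarrow>
     (\<forall>n. V n \<in> borel_measurable M) \<and>
     (\<forall>e>0. (\<lambda>n. measure M {\<omega> \<in> space M. e < \<bar>V n \<omega> - l\<bar>}) \<longlonglongrightarrow> 0)"

text \<open>
  The exceptional event is asked to be covered by a measurable set of small probability, so that the
  notion also makes sense for quantities that are determined only up to a null set;
  for measurable \<open>V n\<close> it is the usual definition, see \<open>bounded_in_prob_measurable\<close>.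
\<close>

definition bounded_in_prob :: "'w measure \<Rightarrow> (nat \<Rightarrow> 'w \<Rightarrow> real) \<Rightarrow> (nat \<Rightarrow> real) \<Rightarrow> bool" where
  "bounded_in_prob M V a \<longleftrightarrow>
     (\<forall>e>0. \<exists>K. \<forall>\<^sub>F n in sequentially.
        \<exists>A\<in>sets M. {\<omega> \<in> space M. K * a n < \<bar>V n \<omega>\<bar>} \<subseteq> A \<and> measure M A \<le> e)"

lemma bounded_in_prob_measurable:
  assumes "prob_space M" and V: "\<And>n. V n \<in> borel_measurable M"
  shows "bounded_in_prob M V a \<longleftrightarrow>
    (\<forall>e>0. \<exists>K. \<forall>\<^sub>F n in sequentially. measure M {\<omega> \<in> space M. K * a n < \<bar>V n \<omega>\<bar>} \<le> e)"
proof -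
  interpret prob_space M by fact
  have meas: "{\<omega> \<in> space M. K * a n < \<bar>V n \<omega>\<bar>} \<in> sets M" for K n
    using V by measurable
  have "(\<exists>A\<in>sets M. {\<omega> \<in> space M. K * a n < \<bar>V n \<omega>\<bar>} \<subseteq> A \<and> measure M A \<le> e) \<longleftrightarrow>
        measure M {\<omega> \<in> space M. K * a n < \<bar>V n \<omega>\<bar>} \<le> e" for K n e
    using meas[of K n] finite_measure_mono order_trans by blast
  then show ?thesis
    unfolding bounded_in_prob_def by simp
qed

definition borel_metric :: "'a metric \<Rightarrow> 'a measure" where
  "borel_metric m = sigma (mspace m) {U. openin (mtopology_of m) U}"

definition conv_in_dist ::
  "'a metric \<Rightarrow> 'w measure \<Rightarrow> (nat \<Rightarrow> 'w \<Rightarrow> 'a) \<Rightarrow> 'v measure \<Rightarrow> ('v \<Rightarrow> 'a) \<Rightarrow> bool" where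
  "conv_in_dist m M G N V \<longleftrightarrow>
     (\<forall>n. G n \<in> M \<rightarrow>\<^sub>M borel_metric m) \<and> V \<in> N \<rightarrow>\<^sub>M borel_metric m \<and>
     (\<forall>h. continuous_map (mtopology_of m) euclideanreal h \<longrightarrow> bounded (h ` mspace m) \<longrightarrow>
        (\<lambda>n. \<integral>\<omega>. h (G n \<omega>) \<partial>M) \<longlonglongrightarrow> (\<integral>\<omega>. h (V \<omega>) \<partial>N))"

text \<open>The Banach space of continuous functions on \<open>Z\<close> with the supremum metric; its elements are
  extensional, i.e. \<open>undefined\<close> outside \<open>Z\<close>.\<close>

abbreviation C_space :: "'a::topological_space set \<Rightarrow> ('a \<Rightarrow> real) metric" where
  "C_space Z \<equiv> cfunspace (top_of_set Z) euclidean_metric"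

section \<open>The stochastic program and its sample approximations\<close>

definition true_obj ::
  "(real^'dz \<Rightarrow> real^'dy \<Rightarrow> real) \<Rightarrow> (real^'dx \<Rightarrow> real^'dy) \<Rightarrow> (real^'dx \<Rightarrow> real^'dy^'dy) \<Rightarrow>
   (real^'dy) measure \<Rightarrow> real^'dz \<Rightarrow> real^'dx \<Rightarrow> real" where
  "true_obj c f Q P z x = (\<integral>e. c z (f x + Q x *v e) \<partial>P)"

definition residual ::
  "(real^'dx \<Rightarrow> real^'dy) \<Rightarrow> (real^'dx \<Rightarrow> real^'dy^'dy) \<Rightarrow> (real^'dy) \<times> (real^'dx) \<Rightarrow> real^'dy" where
  "residual f Q = (\<lambda>(y, x). matrix_inv (Q x) *v (y - f x))"

text \<open>A data set is a sequence \<open>d\<close> of pairs \<open>(y, x)\<close>, of which the entries with index in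
  \<open>{1..n}\<close> are used.\<close>

definition saa_obj ::
  "(real^'dz \<Rightarrow> real^'dy \<Rightarrow> real) \<Rightarrow> (real^'dx \<Rightarrow> real^'dy) \<Rightarrow> (real^'dx \<Rightarrow> real^'dy^'dy) \<Rightarrow>
   nat \<Rightarrow> (nat \<Rightarrow> (real^'dy) \<times> (real^'dx)) \<Rightarrow> real^'dz \<Rightarrow> real^'dx \<Rightarrow> real" where
  "saa_obj c f Q n d z x = (1 / real n) * (\<Sum>i=1..n. c z (f x + Q x *v residual f Q (d i)))"

definition er_obj ::
  "(real^'dz \<Rightarrow> real^'dy \<Rightarrow> real) \<Rightarrow> (real^'dy) set \<Rightarrow>
   (real^'dx \<Rightarrow> real^'dy) \<Rightarrow> (real^'dx \<Rightarrow> real^'dy^'dy) \<Rightarrow>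
   nat \<Rightarrow> (nat \<Rightarrow> (real^'dy) \<times> (real^'dx)) \<Rightarrow> real^'dz \<Rightarrow> real^'dx \<Rightarrow> real" where
  "er_obj c \<Y> f Q n d z x =
     (1 / real n) * (\<Sum>i=1..n. c z (closest_point \<Y> (f x + Q x *v residual f Q (d i))))"

text \<open>This is the minimum whenever the minimum is attained.\<close>

definition opt_value :: "'a set \<Rightarrow> ('a \<Rightarrow> real) \<Rightarrow> real" where
  "opt_value Z g = (INF z\<in>Z. g z)"

end

theory Submission
  imports Defs
begin

text \<open>
  Fix a covariate \<open>u\<close> outside the exceptional null set and write
  \<open>a n = n powr (- \<alpha> / 2)\<close>. Both quantities in the theorem are at most
  \<open>sup\<^sub>z \<bar>gER n \<omega> z u - g z u\<bar>\<close>: moving an objective function by at most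
  \<open>\<rho>\<close>, uniformly on the feasible set, moves its infimum by at most \<open>\<rho>\<close>, and its
  values at a given point too (\<open>opt_value_perturbation\<close>). So it suffices that this
  supremum is \<open>O\<^sub>p(a n)\<close>, and it splits at the full-information objective \<open>gs\<close>.

  The sampling error \<open>gs - g\<close>: continuous images of a sequence that converges in
  distribution converge in distribution, and real sequences that do so are bounded in
  probability. For the distance to the zero function in the space of continuous functions this
  gives the uniform rate \<open>1 / sqrt n\<close>, which is at most \<open>a n\<close> because
  \<open>\<alpha> \<le> 1\<close> (\<open>bounded_in_prob_uniform_deviation\<close>).

  The estimation error \<open>gER - gs\<close>: the Lipschitz bound is uniform in \<open>z\<close>, projection
  onto a closed convex set is nonexpansive and fixes the true scenarios, so the error is at most a
  constant times the mean distance between estimated and true scenarios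
  (\<open>er_obj_saa_obj_diff_le\<close>). With \<open>e\<^sub>i\<close> the true residuals,
  \<open>\<Delta>\<^sub>i\<close> the error of the inverse scale matrix and \<open>\<delta>\<^sub>i\<close> that of the
  regression function at the \<open>i\<close>-th data point, the \<open>i\<close>-th residual is off by at most
  \<open>\<Delta>\<^sub>i \<parallel>Q(x\<^sub>i)\<parallel> \<parallel>e\<^sub>i\<parallel> + \<Delta>\<^sub>i \<delta>\<^sub>i + \<parallel>Q(x\<^sub>i)\<inverse>\<parallel> \<delta>\<^sub>i\<close>
  (\<open>norm_residual_diff_le\<close>). By the Cauchy-Schwarz inequality the means of these three
  products are controlled by the mean squares of \<open>\<Delta>\<^sub>i\<close> and \<open>\<delta>\<^sub>i\<close>, which are
  \<open>O\<^sub>p(a n ^ 2)\<close>, and by the empirical moments of \<open>Q\<close>, its inverse and the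
  residuals, which are \<open>O\<^sub>p(1)\<close> because they converge in probability
  (\<open>mean_perturbation_le\<close>).
\<close>

section \<open>A calculus of stochastic boundedness\<close>

lemma bounded_in_prob_mono:
  assumes V: "bounded_in_prob M V a"
    and le: "\<forall>\<^sub>F n in sequentially. AE \<omega> in M. \<bar>W n \<omega>\<bar> \<le> \<bar>V n \<omega>\<bar>"
  shows "bounded_in_prob M W a"
  unfolding bounded_in_prob_def
proof (intro allI impI)
  fix e :: real assume "e > 0"
  then obtain K where K: "\<forall>\<^sub>F n in sequentially.
      \<exists>A\<in>sets M. {\<omega> \<in> space M. K * a n < \<bar>V n \<omega>\<bar>} \<subseteq> A \<and> measure M A \<le> e"
    using V unfolding bounded_in_prob_def by blast
  have "\<forall>\<^sub>F n in sequentially.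
      \<exists>A\<in>sets M. {\<omega> \<in> space M. K * a n < \<bar>W n \<omega>\<bar>} \<subseteq> A \<and> measure M A \<le> e"
    using K le
  proof eventually_elim
    case (elim n)
    obtain A where A: "A \<in> sets M" "{\<omega> \<in> space M. K * a n < \<bar>V n \<omega>\<bar>} \<subseteq> A" "measure M A \<le> e"
      using elim(1) by blast
    obtain B where B: "{\<omega> \<in> space M. \<not> \<bar>W n \<omega>\<bar> \<le> \<bar>V n \<omega>\<bar>} \<subseteq> B" "emeasure M B = 0" "B \<in> sets M"
      using elim(2) by (rule AE_E)
    have "{\<omega> \<in> space M. K * a n < \<bar>W n \<omega>\<bar>} \<subseteq> A \<union> B"
      using A(2) B(1) by force
    moreover have "measure M (A \<union> B) \<le> e"
      using measure_Un_le[OF A(1) B(3)] A(3) B(2) by (simp add: measure_def)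
    ultimately show ?case
      using A(1) B(3) by blast
  qed
  then show "\<exists>K. \<forall>\<^sub>F n in sequentially.
      \<exists>A\<in>sets M. {\<omega> \<in> space M. K * a n < \<bar>W n \<omega>\<bar>} \<subseteq> A \<and> measure M A \<le> e" ..
qed

text \<open>
  The common reason for the closure properties below: outside the union of two exceptional events,
  each of probability at most \<open>e / 2\<close>, both bounds hold, with constants \<open>K\<close> and
  \<open>K'\<close>. The function \<open>C\<close> says how the constant for the result arises from these two.
\<close>

lemma bounded_in_prob_combine:
  assumes V: "bounded_in_prob M V a" and W: "bounded_in_prob M W b"
    and R: "\<And>K K' n \<omega>. \<bar>V n \<omega>\<bar> \<le> K * a n \<Longrightarrow> \<bar>W n \<omega>\<bar> \<le> K' * b n \<Longrightarrow> \<bar>R n \<omega>\<bar> \<le> C K K' * r n"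
  shows "bounded_in_prob M R r"
  unfolding bounded_in_prob_def
proof (intro allI impI)
  fix e :: real assume "e > 0"
  then have e: "e / 2 > 0" by simp
  obtain K where K: "\<forall>\<^sub>F n in sequentially.
      \<exists>A\<in>sets M. {\<omega> \<in> space M. K * a n < \<bar>V n \<omega>\<bar>} \<subseteq> A \<and> measure M A \<le> e / 2"
    using V e unfolding bounded_in_prob_def by blast
  obtain K' where K': "\<forall>\<^sub>F n in sequentially.
      \<exists>A\<in>sets M. {\<omega> \<in> space M. K' * b n < \<bar>W n \<omega>\<bar>} \<subseteq> A \<and> measure M A \<le> e / 2"
    using W e unfolding bounded_in_prob_def by blast
  have "\<forall>\<^sub>F n in sequentially.
      \<exists>A\<in>sets M. {\<omega> \<in> space M. C K K' * r n < \<bar>R n \<omega>\<bar>} \<subseteq> A \<and> measure M A \<le> e"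
    using K K'
  proof eventually_elim
    case (elim n)
    obtain A B where A: "A \<in> sets M" "{\<omega> \<in> space M. K * a n < \<bar>V n \<omega>\<bar>} \<subseteq> A" "measure M A \<le> e / 2"
      and B: "B \<in> sets M" "{\<omega> \<in> space M. K' * b n < \<bar>W n \<omega>\<bar>} \<subseteq> B" "measure M B \<le> e / 2"
      using elim by blast
    have "{\<omega> \<in> space M. C K K' * r n < \<bar>R n \<omega>\<bar>} \<subseteq> A \<union> B"
      using A(2) B(2) R[of n _ K K'] by (force simp: not_le[symmetric])
    moreover have "measure M (A \<union> B) \<le> e"
      using measure_Un_le[OF A(1) B(1)] A(3) B(3) by simp
    ultimately show ?case
      using A(1) B(1) by blast
  qed
  then show "\<exists>K. \<forall>\<^sub>F n in sequentially.
      \<exists>A\<in>sets M. {\<omega> \<in> space M. K * r n < \<bar>R n \<omega>\<bar>} \<subseteq> A \<and> measure M A \<le> e" ..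
qed

lemma bounded_in_prob_const: "bounded_in_prob M (\<lambda>n \<omega>. k) (\<lambda>_. 1)"
  unfolding bounded_in_prob_def
  by (intro allI impI exI[of _ "\<bar>k\<bar>"] always_eventually bexI[of _ "{}"]) auto

lemma bounded_in_prob_scale:
  assumes V: "bounded_in_prob M V a" and b: "\<And>n. 0 \<le> b n"
  shows "bounded_in_prob M (\<lambda>n \<omega>. V n \<omega> * b n) (\<lambda>n. a n * b n)"
proof (rule bounded_in_prob_combine[OF V V, where C = "\<lambda>K K'. K"])
  fix K K' n \<omega> assume "\<bar>V n \<omega>\<bar> \<le> K * a n"
  then show "\<bar>V n \<omega> * b n\<bar> \<le> K * (a n * b n)"
    using mult_right_mono[OF _ b[of n]] by (simp add: abs_mult b flip: mult.assoc)
qed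

lemma bounded_in_prob_add:
  assumes "bounded_in_prob M V a" "bounded_in_prob M W a"
  shows "bounded_in_prob M (\<lambda>n \<omega>. V n \<omega> + W n \<omega>) a"
  by (rule bounded_in_prob_combine[OF assms, where C = "(+)"]) (simp add: algebra_simps)

lemma bounded_in_prob_mult:
  assumes "bounded_in_prob M V a" "bounded_in_prob M W b"
  shows "bounded_in_prob M (\<lambda>n \<omega>. V n \<omega> * W n \<omega>) (\<lambda>n. a n * b n)"
proof (rule bounded_in_prob_combine[OF assms, where C = "(*)"])
  fix K K' n \<omega> assume "\<bar>V n \<omega>\<bar> \<le> K * a n" "\<bar>W n \<omega>\<bar> \<le> K' * b n"
  then have "\<bar>V n \<omega>\<bar> * \<bar>W n \<omega>\<bar> \<le> (K * a n) * (K' * b n)"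
    by (intro mult_mono) auto
  then show "\<bar>V n \<omega> * W n \<omega>\<bar> \<le> K * K' * (a n * b n)"
    by (simp add: abs_mult algebra_simps)
qed

lemma bounded_in_prob_rate_mono:
  assumes V: "bounded_in_prob M V a" and ab: "\<And>n. 0 \<le> a n" "\<And>n. a n \<le> b n"
  shows "bounded_in_prob M V b"
proof (rule bounded_in_prob_combine[OF V V, where C = "\<lambda>K K'. max 0 K"])
  fix K K' n \<omega> assume "\<bar>V n \<omega>\<bar> \<le> K * a n"
  also have "\<dots> \<le> max 0 K * a n"
    using ab(1) by (intro mult_right_mono) auto
  also have "\<dots> \<le> max 0 K * b n"
    using ab(2) by (intro mult_left_mono) auto
  finally show "\<bar>V n \<omega>\<bar> \<le> max 0 K * b n" .
qed

lemma bounded_in_prob_sqrt: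
  assumes V: "bounded_in_prob M V a"
  shows "bounded_in_prob M (\<lambda>n \<omega>. sqrt (V n \<omega>)) (\<lambda>n. sqrt (a n))"
proof (rule bounded_in_prob_combine[OF V V, where C = "\<lambda>K K'. sqrt K"])
  fix K K' n \<omega> assume "\<bar>V n \<omega>\<bar> \<le> K * a n"
  then have "sqrt \<bar>V n \<omega>\<bar> \<le> sqrt K * sqrt (a n)"
    by (simp flip: real_sqrt_mult)
  moreover have "\<bar>sqrt (V n \<omega>)\<bar> = sqrt \<bar>V n \<omega>\<bar>"
    by (cases "V n \<omega> \<ge> 0") (simp_all add: real_sqrt_minus)
  ultimately show "\<bar>sqrt (V n \<omega>)\<bar> \<le> sqrt K * sqrt (a n)" by simp
qed

lemma bounded_in_prob_of_conv_in_prob: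
  assumes V: "conv_in_prob M V l"
  shows "bounded_in_prob M V (\<lambda>_. 1)"
  unfolding bounded_in_prob_def
proof (intro allI impI exI[of _ "\<bar>l\<bar> + 1"])
  fix e :: real assume e: "e > 0"
  have [measurable]: "V n \<in> borel_measurable M" for n
    using V unfolding conv_in_prob_def by blast
  have "(\<lambda>n. measure M {\<omega> \<in> space M. 1 < \<bar>V n \<omega> - l\<bar>}) \<longlonglongrightarrow> 0"
    using V unfolding conv_in_prob_def by simp
  then have "\<forall>\<^sub>F n in sequentially. measure M {\<omega> \<in> space M. 1 < \<bar>V n \<omega> - l\<bar>} < e"
    using e by (rule order_tendstoD)
  then show "\<forall>\<^sub>F n in sequentially. \<exists>A\<in>sets M.
      {\<omega> \<in> space M. (\<bar>l\<bar> + 1) * 1 < \<bar>V n \<omega>\<bar>} \<subseteq> A \<and> measure M A \<le> e"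
  proof eventually_elim
    case (elim n)
    have "{\<omega> \<in> space M. (\<bar>l\<bar> + 1) * 1 < \<bar>V n \<omega>\<bar>} \<subseteq> {\<omega> \<in> space M. 1 < \<bar>V n \<omega> - l\<bar>}"
      by auto
    moreover have "{\<omega> \<in> space M. 1 < \<bar>V n \<omega> - l\<bar>} \<in> sets M"
      by measurable
    ultimately show ?case
      using elim by (meson less_imp_le)
  qed
qed

section \<open>Convergence in distribution and boundedness\<close>

lemma continuous_map_measurable_borel_metric:
  assumes "continuous_map (mtopology_of m) euclideanreal h"
  shows "h \<in> borel_measurable (borel_metric m)"
proof (rule borel_measurableI)
  fix S :: "real set" assume "open S"
  then have "openin (mtopology_of m) {p \<in> topspace (mtopology_of m). h p \<in> S}"
    using assms by (auto simp: continuous_map_def)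
  moreover have "{p \<in> topspace (mtopology_of m). h p \<in> S} = h -` S \<inter> space (borel_metric m)"
    by (auto simp: borel_metric_def space_measure_of_conv)
  moreover have "{U. openin (mtopology_of m) U} \<subseteq> Pow (mspace m)"
    using openin_subset by fastforce
  ultimately show "h -` S \<inter> space (borel_metric m) \<in> sets (borel_metric m)"
    by (simp add: borel_metric_def sets_measure_of)
qed

text \<open>
  The tail probability \<open>P(d > k + 1)\<close> of the distance \<open>d\<close> to \<open>p0\<close> is not an
  expectation of a continuous function, but it is at most that of the ramp
  \<open>min 1 (max 0 (d - k))\<close>, which is bounded and continuous. Its expectation is small at the
  limit for large \<open>k\<close>, and hence, with this \<open>k\<close>, along the tail of the sequence.
\<close>

lemma bounded_in_prob_of_conv_in_dist:
  assumes "prob_space M" "prob_space N"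
    and conv: "conv_in_dist m M G N V" and p0: "p0 \<in> mspace m"
  shows "bounded_in_prob M (\<lambda>n \<omega>. mdist m (G n \<omega>) p0) (\<lambda>_. 1)"
  unfolding bounded_in_prob_def
proof (intro allI impI)
  fix e :: real assume e: "e > 0"
  interpret M: prob_space M by fact
  interpret N: prob_space N by fact
  have G [measurable]: "G n \<in> M \<rightarrow>\<^sub>M borel_metric m" for n
    using conv unfolding conv_in_dist_def by blast
  have V [measurable]: "V \<in> N \<rightarrow>\<^sub>M borel_metric m"
    using conv unfolding conv_in_dist_def by blast
  have dist_cont: "continuous_map (mtopology_of m) euclideanreal (\<lambda>p. mdist m p p0)"
    using p0 by (intro continuous_intros) auto
  then have dist_meas [measurable]: "(\<lambda>p. mdist m p p0) \<in> borel_measurable (borel_metric m)"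
    by (rule continuous_map_measurable_borel_metric)
  define ramp where "ramp k p = min 1 (max 0 (mdist m p p0 - real k))" for k p
  have ramp_meas [measurable]: "ramp k \<in> borel_measurable (borel_metric m)" for k
    unfolding ramp_def by measurable
  have ramp_bounds: "0 \<le> ramp k p" "ramp k p \<le> 1" for k p
    unfolding ramp_def by auto
  have "(\<lambda>k. \<integral>\<omega>. ramp k (V \<omega>) \<partial>N) \<longlonglongrightarrow> (\<integral>\<omega>. 0 \<partial>N)"
  proof (rule integral_dominated_convergence[where w = "\<lambda>_. 1"])
    show "AE \<omega> in N. (\<lambda>k. ramp k (V \<omega>)) \<longlonglongrightarrow> 0"
    proof (intro AE_I2 tendsto_eventually)
      fix \<omega>
      have "\<forall>\<^sub>F k in sequentially. mdist m (V \<omega>) p0 \<le> real k"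
        using filterlim_real_sequentially unfolding filterlim_at_top by blast
      then show "\<forall>\<^sub>F k in sequentially. ramp k (V \<omega>) = 0"
        by eventually_elim (simp add: ramp_def)
    qed
  qed (use ramp_bounds in auto)
  then have "\<forall>\<^sub>F k in sequentially. (\<integral>\<omega>. ramp k (V \<omega>) \<partial>N) < e"
    using e by (intro order_tendstoD) auto
  then obtain k where k: "(\<integral>\<omega>. ramp k (V \<omega>) \<partial>N) < e"
    by (auto simp: eventually_sequentially)
  have "continuous_map (mtopology_of m) euclideanreal (ramp k)"
    unfolding ramp_def by (intro continuous_intros) (use p0 in auto)
  moreover have "bounded (ramp k ` mspace m)"
    using ramp_bounds[of k] by (auto intro!: boundedI[where B = 1])
  ultimately have "(\<lambda>n. \<integral>\<omega>. ramp k (G n \<omega>) \<partial>M) \<longlonglongrightarrow> (\<integral>\<omega>. ramp k (V \<omega>) \<partial>N)"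
    using conv unfolding conv_in_dist_def by blast
  then have ev: "\<forall>\<^sub>F n in sequentially. (\<integral>\<omega>. ramp k (G n \<omega>) \<partial>M) < e"
    using k by (rule order_tendstoD)
  have "\<forall>\<^sub>F n in sequentially. \<exists>A\<in>sets M.
      {\<omega> \<in> space M. (real k + 1) * 1 < \<bar>mdist m (G n \<omega>) p0\<bar>} \<subseteq> A \<and> measure M A \<le> e"
    using ev
  proof eventually_elim
    case (elim n)
    let ?A = "{\<omega> \<in> space M. real k + 1 < mdist m (G n \<omega>) p0}"
    have A [measurable]: "?A \<in> sets M"
      by measurable
    have "measure M ?A = (\<integral>\<omega>. indicator ?A \<omega> \<partial>M)"
      by (simp add: Int_absorb2 subset_iff)
    also have "\<dots> \<le> (\<integral>\<omega>. ramp k (G n \<omega>) \<partial>M)"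
    proof (rule integral_mono)
      show "integrable M (\<lambda>\<omega>. ramp k (G n \<omega>))"
        using ramp_bounds by (intro M.integrable_const_bound[where B = 1]) auto
      show "indicator ?A \<omega> \<le> ramp k (G n \<omega>)" for \<omega>
        using ramp_bounds(1)[of k "G n \<omega>"] by (auto simp: indicator_def ramp_def)
      show "integrable M (indicator ?A :: _ \<Rightarrow> real)"
        by (intro M.integrable_const_bound[where B = 1]) auto
    qed
    finally have "measure M ?A \<le> e"
      using elim by simp
    then show ?case
      using A by (intro bexI[of _ ?A]) auto
  qed
  then show "\<exists>K. \<forall>\<^sub>F n in sequentially. \<exists>A\<in>sets M.
      {\<omega> \<in> space M. K * 1 < \<bar>mdist m (G n \<omega>) p0\<bar>} \<subseteq> A \<and> measure M A \<le> e" ..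
qed

lemma bounded_in_prob_uniform_deviation:
  assumes "prob_space M" "prob_space N"
    and conv: "conv_in_dist (C_space Z) M G N V"
    and G: "\<forall>n\<ge>1. AE \<omega> in M. G n \<omega> = (\<lambda>z\<in>Z. sqrt (real n) * (h n \<omega> z - k z))"
  obtains W where "bounded_in_prob M W (\<lambda>n. real n powr (- 1 / 2))"
    and "\<forall>n\<ge>1. AE \<omega> in M. \<forall>z\<in>Z. \<bar>h n \<omega> z - k z\<bar> \<le> W n \<omega>"
proof
  let ?o = "\<lambda>z\<in>Z. 0 :: real"
  let ?W = "\<lambda>n \<omega>. mdist (C_space Z) (G n \<omega>) ?o"
  have p0: "?o \<in> mspace (C_space Z)"
    by (auto simp: image_constant_conv intro: continuous_map_eq[where f = "\<lambda>_. 0"] finite_imp_bounded)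
  have "bounded_in_prob M ?W (\<lambda>_. 1)"
    using assms p0 by (intro bounded_in_prob_of_conv_in_dist)
  from bounded_in_prob_scale[OF this, of "\<lambda>n. real n powr (- 1 / 2)"]
  show "bounded_in_prob M (\<lambda>n \<omega>. ?W n \<omega> * real n powr (- 1 / 2)) (\<lambda>n. real n powr (- 1 / 2))"
    by simp
  show "\<forall>n\<ge>1. AE \<omega> in M. \<forall>z\<in>Z. \<bar>h n \<omega> z - k z\<bar> \<le> ?W n \<omega> * real n powr (- 1 / 2)"
  proof (intro allI impI)
    fix n :: nat assume n: "1 \<le> n"
    have "AE \<omega> in M. G n \<omega> \<in> mspace (C_space Z)"
      using conv measurable_space[of "G n" M "borel_metric (C_space Z)"]
      unfolding conv_in_dist_def borel_metric_def space_measure_of_conv by (intro AE_I2) blast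
    then show "AE \<omega> in M. \<forall>z\<in>Z. \<bar>h n \<omega> z - k z\<bar> \<le> ?W n \<omega> * real n powr (- 1 / 2)"
      using G[rule_format, OF n]
    proof eventually_elim
      case (elim \<omega>)
      show ?case
      proof
        fix z assume z: "z \<in> Z"
        have "mdist euclidean_metric (G n \<omega> z) (?o z) \<le> ?W n \<omega>"
          using z by (intro mdist_cfunspace_imp_mdist_le[OF elim(1) p0 order_refl]) simp
        then have "sqrt (real n) * \<bar>h n \<omega> z - k z\<bar> \<le> ?W n \<omega>"
          using z unfolding elim(2) by (simp add: dist_real_def abs_mult)
        then have "\<bar>h n \<omega> z - k z\<bar> \<le> ?W n \<omega> / sqrt (real n)"
          using n by (simp add: pos_le_divide_eq mult.commute)
        also have "\<dots> = ?W n \<omega> * real n powr (- 1 / 2)"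
          using n powr_minus_divide[of "real n" "1 / 2"] by (simp add: powr_half_sqrt)
        finally show "\<bar>h n \<omega> z - k z\<bar> \<le> ?W n \<omega> * real n powr (- 1 / 2)" .
      qed
    qed
  qed
qed

section \<open>Matrix norms and residuals\<close>

lemma norm_matrix_vector_mult_le: "norm (A *v v) \<le> mnorm A * norm v"
  unfolding mnorm_def by (rule onorm) (rule matrix_vector_mul_bounded_linear)

lemma mnorm_nonneg: "0 \<le> mnorm A"
  unfolding mnorm_def by (rule onorm_pos_le) (rule matrix_vector_mul_bounded_linear)

lemma invertible_of_pos_def:
  assumes "pos_def (A :: real^'n^'n)"
  shows "invertible A"
proof -
  have "v = 0" if "A *v v = 0" for v
    using assms that unfolding pos_def_def by force
  then show ?thesis
    unfolding invertible_left_inverse matrix_left_invertible_ker by blast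
qed

lemma matrix_inv_cancel_left:
  assumes "invertible (A :: real^'n^'n)"
  shows "A *v (matrix_inv A *v v) = v"
proof -
  have "A ** matrix_inv A = mat 1"
    using someI_ex[OF assms[unfolded invertible_def]] unfolding matrix_inv_def by blast
  then show ?thesis
    by (simp add: matrix_vector_mul_assoc)
qed

text \<open>
  Since \<open>b - f a = Q a *v r\<close> for the true residual \<open>r\<close>, the difference is
  \<open>D *v (Q a *v r) - D *v (f' a - f a) - matrix_inv (Q a) *v (f' a - f a)\<close> where
  \<open>D\<close> is the difference of the inverses. Expanding around the true inverse leaves only
  estimation errors, which are small on average, and factors from the true model.
\<close>

lemma norm_residual_diff_le:
  fixes f f' :: "real^'dx \<Rightarrow> real^'dy" and Q Q' :: "real^'dx \<Rightarrow> real^'dy^'dy"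
    and a :: "real^'dx" and b :: "real^'dy"
  assumes "invertible (Q a)"
  defines "e \<equiv> norm (residual f Q (b, a))"
    and "\<Delta> \<equiv> mnorm (matrix_inv (Q' a) - matrix_inv (Q a))" and "\<delta> \<equiv> norm (f' a - f a)"
  shows "norm (residual f' Q' (b, a) - residual f Q (b, a))
    \<le> \<Delta> * (mnorm (Q a) * e) + \<Delta> * \<delta> + mnorm (matrix_inv (Q a)) * \<delta>"
proof -
  let ?D = "matrix_inv (Q' a) - matrix_inv (Q a)" and ?r = "residual f Q (b, a)"
  have "Q a *v ?r = b - f a"
    unfolding residual_def by (simp add: matrix_inv_cancel_left[OF assms(1)])
  then have eq: "residual f' Q' (b, a) - ?r =
      ?D *v (Q a *v ?r) - ?D *v (f' a - f a) - matrix_inv (Q a) *v (f' a - f a)"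
    unfolding residual_def
    by (simp add: matrix_vector_mult_diff_distrib matrix_vector_mult_diff_rdistrib)
  have "norm (?D *v (Q a *v ?r)) \<le> \<Delta> * norm (Q a *v ?r)"
    unfolding \<Delta>_def by (rule norm_matrix_vector_mult_le)
  also have "\<dots> \<le> \<Delta> * (mnorm (Q a) * e)"
    unfolding \<Delta>_def e_def by (intro mult_left_mono norm_matrix_vector_mult_le mnorm_nonneg)
  finally have 1: "norm (?D *v (Q a *v ?r)) \<le> \<Delta> * (mnorm (Q a) * e)" .
  have 2: "norm (?D *v (f' a - f a)) \<le> \<Delta> * \<delta>"
    unfolding \<Delta>_def \<delta>_def by (rule norm_matrix_vector_mult_le)
  have 3: "norm (matrix_inv (Q a) *v (f' a - f a)) \<le> mnorm (matrix_inv (Q a)) * \<delta>"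
    unfolding \<delta>_def by (rule norm_matrix_vector_mult_le)
  show ?thesis
    unfolding eq using 1 2 3 norm_triangle_ineq4 by (smt (verit))
qed

text \<open>
  As for the residuals, \<open>Q' u\<close> is replaced by \<open>Q u + (Q' u - Q u)\<close>, so that only the true
  matrix and the estimation error enter.
\<close>

lemma norm_scenario_diff_le:
  fixes Q Q' :: "real^'dx \<Rightarrow> real^'dy^'dy"
  shows "norm ((f' u + Q' u *v r') - (f u + Q u *v r))
    \<le> norm (f' u - f u) + mnorm (Q' u - Q u) * norm r
       + (mnorm (Q u) + mnorm (Q' u - Q u)) * norm (r' - r)"
proof -
  have "(f' u + Q' u *v r') - (f u + Q u *v r) =
      (f' u - f u) + ((Q' u - Q u) *v r + (Q u *v (r' - r) + (Q' u - Q u) *v (r' - r)))"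
    by (simp add: matrix_vector_mult_diff_distrib matrix_vector_mult_diff_rdistrib)
  also have "norm \<dots> \<le> norm (f' u - f u) + (norm ((Q' u - Q u) *v r)
      + (norm (Q u *v (r' - r)) + norm ((Q' u - Q u) *v (r' - r))))"
    by (intro norm_triangle_mono norm_triangle_ineq order_refl)
  also have "\<dots> \<le> norm (f' u - f u) + (mnorm (Q' u - Q u) * norm r
      + (mnorm (Q u) * norm (r' - r) + mnorm (Q' u - Q u) * norm (r' - r)))"
    by (intro add_mono norm_matrix_vector_mult_le order_refl)
  finally show ?thesis
    by (simp add: algebra_simps)
qed

section \<open>Empirical means\<close>

abbreviation (input) mean :: "nat \<Rightarrow> (nat \<Rightarrow> real) \<Rightarrow> real" where
  "mean n v \<equiv> (1 / real n) * (\<Sum>i=1..n. v i)"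

lemma mean_mono: "(\<And>i. i \<in> {1..n} \<Longrightarrow> v i \<le> w i) \<Longrightarrow> mean n v \<le> mean n w"
  by (intro mult_left_mono sum_mono) auto

lemma mean_nonneg: "(\<And>i. i \<in> {1..n} \<Longrightarrow> 0 \<le> v i) \<Longrightarrow> 0 \<le> mean n v"
  by (intro mult_nonneg_nonneg sum_nonneg) auto

lemma mean_add: "mean n (\<lambda>i. v i + w i) = mean n v + mean n w"
  by (simp add: sum.distrib algebra_simps)

lemma mean_cmult: "mean n (\<lambda>i. k * v i) = k * mean n v"
  by (simp add: sum_distrib_left algebra_simps)

lemma mean_const: "1 \<le> n \<Longrightarrow> mean n (\<lambda>i. k) = k"
  by simp

lemma mean_mult_le: "mean n (\<lambda>i. v i * w i) \<le> sqrt (mean n (\<lambda>i. v i ^ 2)) * sqrt (mean n (\<lambda>i. w i ^ 2))"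
proof -
  have "(mean n (\<lambda>i. v i * w i))\<^sup>2 = (1 / real n)\<^sup>2 * (\<Sum>i=1..n. v i * w i)\<^sup>2"
    by (rule power_mult_distrib)
  also have "\<dots> \<le> (1 / real n)\<^sup>2 * ((\<Sum>i=1..n. v i ^ 2) * (\<Sum>i=1..n. w i ^ 2))"
    by (intro mult_left_mono Cauchy_Schwarz_ineq_sum) auto
  also have "\<dots> = mean n (\<lambda>i. v i ^ 2) * mean n (\<lambda>i. w i ^ 2)"
    by (simp add: power2_eq_square)
  finally show ?thesis
    unfolding real_sqrt_mult[symmetric] by (rule real_le_rsqrt)
qed

text \<open>
  Averaging the pointwise bounds on the scenario errors. In the product of three factors the
  Cauchy-Schwarz inequality separates \<open>\<Delta>\<close> from \<open>Q * e\<close>, whose square is split by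
  \<open>t * s \<le> t\<^sup>2 + s\<^sup>2\<close>; this is where fourth moments are needed.
\<close>

lemma mean_perturbation_le:
  fixes \<Delta> \<delta> e J Q h :: "nat \<Rightarrow> real" and n :: nat
  assumes n: "1 \<le> n" and nn: "0 \<le> B" "0 \<le> q" "\<And>i. 0 \<le> \<Delta> i" 
    and h: "\<And>i. i \<in> {1..n} \<Longrightarrow> h i \<le> F + q * e i + (B + q) * (\<Delta> i * (Q i * e i) + \<Delta> i * \<delta> i + J i * \<delta> i)"
  defines "T \<equiv> mean n (\<lambda>i. \<Delta> i ^ 2)" and "S \<equiv> mean n (\<lambda>i. \<delta> i ^ 2)" and "I \<equiv> mean n (\<lambda>i. J i ^ 2)"
    and "Q4 \<equiv> mean n (\<lambda>i. Q i ^ 4)" and "E4 \<equiv> mean n (\<lambda>i. e i ^ 4)"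
  shows "mean n h \<le> F + q * (1 + E4)
    + (B + q) * (sqrt T * sqrt (Q4 + E4) + sqrt T * sqrt S + sqrt I * sqrt S)"
proof -
  have sq_le: "t * s \<le> t\<^sup>2 + s\<^sup>2" for t s :: real
    using zero_le_power2[of "t - s"] zero_le_power2[of "t + s"] unfolding power2_sum power2_diff by linarith
  have "mean n (\<lambda>i. (Q i * e i) ^ 2) \<le> mean n (\<lambda>i. Q i ^ 4 + e i ^ 4)"
    using sq_le[of "(Q _)\<^sup>2" "(e _)\<^sup>2"] by (intro mean_mono) (simp add: power_mult_distrib)
  then have QE: "mean n (\<lambda>i. (Q i * e i) ^ 2) \<le> Q4 + E4"
    unfolding mean_add Q4_def E4_def .
  have "t \<le> 1 + t ^ 4" for t :: real
    using sq_le[of t 1] sq_le[of "t\<^sup>2" 1] zero_le_power2[of "t\<^sup>2 - 1/2"] zero_le_power2[of "t - 1/2"]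
    by (simp add: power2_diff power_divide)
  then have "mean n e \<le> mean n (\<lambda>i. 1 + e i ^ 4)"
    by (intro mean_mono)
  then have E: "mean n e \<le> 1 + E4"
    unfolding mean_add mean_const[OF n] E4_def .
  have T_nonneg: "0 \<le> sqrt T"
    unfolding T_def by (intro real_sqrt_ge_zero mean_nonneg) simp
  have "mean n h \<le> mean n (\<lambda>i. F + q * e i + (B + q) * (\<Delta> i * (Q i * e i) + \<Delta> i * \<delta> i + J i * \<delta> i))"
    using h by (rule mean_mono)
  also have "\<dots> = F + q * mean n e + (B + q) * (mean n (\<lambda>i. \<Delta> i * (Q i * e i))
      + mean n (\<lambda>i. \<Delta> i * \<delta> i) + mean n (\<lambda>i. J i * \<delta> i))"
    unfolding mean_add mean_cmult mean_const[OF n] ..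
  also have "\<dots> \<le> F + q * (1 + E4) + (B + q) * (sqrt T * sqrt (mean n (\<lambda>i. (Q i * e i) ^ 2))
      + sqrt T * sqrt S + sqrt I * sqrt S)"
    unfolding T_def S_def I_def
    by (intro add_mono mult_left_mono mean_mult_le E order_refl add_nonneg_nonneg nn)
  also have "\<dots> \<le> F + q * (1 + E4) + (B + q) * (sqrt T * sqrt (Q4 + E4) + sqrt T * sqrt S + sqrt I * sqrt S)"
    by (intro add_mono mult_left_mono mult_right_mono real_sqrt_le_mono QE order_refl add_nonneg_nonneg nn T_nonneg)
  finally show ?thesis .
qed

section \<open>Supports, projections and minima\<close>

text \<open>The complement is the union of the open null sets.\<close>

lemma closed_topological_support: "closed (topological_support \<mu>)"
proof -
  have "- topological_support \<mu> = \<Union> {U. open U \<and> emeasure \<mu> U = 0}"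
    unfolding topological_support_def by (auto simp: zero_less_iff_neq_zero)
  then show ?thesis
    unfolding closed_def by auto
qed

text \<open>
  Since \<open>h\<close> attains its minimum at \<open>z0\<close>, the function \<open>k\<close> is bounded below by
  \<open>h z0 - \<rho>\<close>, and its infimum lies between this number and \<open>k z0\<close>.
\<close>

lemma opt_value_perturbation:
  fixes h k :: "'a \<Rightarrow> real"
  assumes h: "is_arg_min h (\<lambda>z. z \<in> Z) z0" and close: "\<And>z. z \<in> Z \<Longrightarrow> \<bar>h z - k z\<bar> \<le> \<rho>"
  shows "\<bar>opt_value Z h - opt_value Z k\<bar> \<le> \<rho>" "\<bar>k z0 - opt_value Z h\<bar> \<le> \<rho>"
proof -
  have z0: "z0 \<in> Z" and min: "\<And>z. z \<in> Z \<Longrightarrow> h z0 \<le> h z"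
    using h by (auto simp: is_arg_min_linorder)
  have h_min: "opt_value Z h = h z0"
    unfolding opt_value_def using z0 min by (intro cInf_eq_minimum) auto
  have lower: "h z0 - \<rho> \<le> k z" if "z \<in> Z" for z
    using min[OF that] close[OF that] by linarith
  have "h z0 - \<rho> \<le> opt_value Z k"
    unfolding opt_value_def using z0 lower by (intro cINF_greatest) auto
  moreover have "opt_value Z k \<le> k z0"
    unfolding opt_value_def using z0 lower by (intro cINF_lower bdd_belowI2) auto
  ultimately show "\<bar>opt_value Z h - opt_value Z k\<bar> \<le> \<rho>" "\<bar>k z0 - opt_value Z h\<bar> \<le> \<rho>"
    using close[OF z0] h_min by linarith+
qed

text \<open>
  The true scenarios lie in \<open>Y\<close> and are fixed by the projection, so comparing an unprojected
  true scenario with a projected estimated one costs no more than the distance before projecting.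
\<close>

lemma er_obj_saa_obj_diff_le:
  assumes Y: "closed Y" "convex Y" "Y \<noteq> {}"
    and lip: "\<And>s t. s \<in> Y \<Longrightarrow> t \<in> Y \<Longrightarrow> \<bar>c z t - c z s\<bar> \<le> B * norm (t - s)" and B: "0 \<le> B"
    and inY: "\<And>i. i \<in> {1..n} \<Longrightarrow> f u + Q u *v residual f Q (d i) \<in> Y"
  shows "\<bar>er_obj c Y f' Q' n d z u - saa_obj c f Q n d z u\<bar>
    \<le> B * mean n (\<lambda>i. norm ((f' u + Q' u *v residual f' Q' (d i)) - (f u + Q u *v residual f Q (d i))))"
proof -
  let ?p = "\<lambda>i. f' u + Q' u *v residual f' Q' (d i)" and ?q = "\<lambda>i. f u + Q u *v residual f Q (d i)"
  have diff: "\<bar>c z (closest_point Y (?p i)) - c z (?q i)\<bar> \<le> B * norm (?p i - ?q i)"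
    if i: "i \<in> {1..n}" for i
  proof -
    have "\<bar>c z (closest_point Y (?p i)) - c z (?q i)\<bar> \<le> B * norm (closest_point Y (?p i) - ?q i)"
      using Y i by (intro lip inY closest_point_in_set)
    also have "norm (closest_point Y (?p i) - ?q i) \<le> norm (?p i - ?q i)"
      using closest_point_lipschitz[OF Y(2,1,3), of "?p i" "?q i"] closest_point_self[OF inY[OF i]]
      by (simp add: dist_norm)
    finally show ?thesis
      using B by (simp add: mult_left_mono)
  qed
  have "\<bar>er_obj c Y f' Q' n d z u - saa_obj c f Q n d z u\<bar>
      = (1 / real n) * \<bar>\<Sum>i=1..n. c z (closest_point Y (?p i)) - c z (?q i)\<bar>"
    unfolding er_obj_def saa_obj_def by (simp add: sum_subtractf abs_mult flip: diff_divide_distrib)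
  also have "\<dots> \<le> mean n (\<lambda>i. \<bar>c z (closest_point Y (?p i)) - c z (?q i)\<bar>)"
    by (intro mult_left_mono sum_abs) auto
  also have "\<dots> \<le> mean n (\<lambda>i. B * norm (?p i - ?q i))"
    using diff by (rule mean_mono)
  finally show ?thesis
    unfolding mean_cmult .
qed

theorem theorem13:
  fixes \<Omega> :: "'p measure" and M :: "'w measure" and N :: "'v measure"
    and X :: "'p \<Rightarrow> real^'dx" and Y :: "'p \<Rightarrow> real^'dy" and \<epsilon> :: "'p \<Rightarrow> real^'dy"
    and P\<^sub>X :: "(real^'dx) measure" and P\<^sub>\<epsilon> :: "(real^'dy) measure"
    and \<X> :: "(real^'dx) set" and \<Y> :: "(real^'dy) set" and \<Z> :: "(real^'dz) set"
    and c :: "real^'dz \<Rightarrow> real^'dy \<Rightarrow> real"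
    and fs :: "real^'dx \<Rightarrow> real^'dy" and Qs :: "real^'dx \<Rightarrow> real^'dy^'dy"
    and x :: "nat \<Rightarrow> 'w \<Rightarrow> real^'dx" and y :: "nat \<Rightarrow> 'w \<Rightarrow> real^'dy"
    and D :: "nat \<Rightarrow> 'w \<Rightarrow> nat \<Rightarrow> (real^'dy) \<times> (real^'dx)"
    and fhat :: "nat \<Rightarrow> (nat \<Rightarrow> (real^'dy) \<times> (real^'dx)) \<Rightarrow> real^'dx \<Rightarrow> real^'dy"
    and Qhat :: "nat \<Rightarrow> (nat \<Rightarrow> (real^'dy) \<times> (real^'dx)) \<Rightarrow> real^'dx \<Rightarrow> real^'dy^'dy"
    and g :: "real^'dz \<Rightarrow> real^'dx \<Rightarrow> real"
    and gs :: "nat \<Rightarrow> 'w \<Rightarrow> real^'dz \<Rightarrow> real^'dx \<Rightarrow> real"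
    and gER :: "nat \<Rightarrow> 'w \<Rightarrow> real^'dz \<Rightarrow> real^'dx \<Rightarrow> real"
    and vs :: "real^'dx \<Rightarrow> real"
    and vER :: "nat \<Rightarrow> 'w \<Rightarrow> real^'dx \<Rightarrow> real"
    and zER :: "nat \<Rightarrow> 'w \<Rightarrow> real^'dx \<Rightarrow> real^'dz"
    and L :: "real^'dz \<Rightarrow> real"
    and V :: "real^'dx \<Rightarrow> 'v \<Rightarrow> real^'dz \<Rightarrow> real"
    and \<alpha> :: real
  \<comment> \<open>population model\<close>
  assumes "prob_space \<Omega>"
    and "X \<in> borel_measurable \<Omega>" and "Y \<in> borel_measurable \<Omega>" and "\<epsilon> \<in> borel_measurable \<Omega>"
    and PX: "P\<^sub>X = distr \<Omega> borel X" and Peps: "P\<^sub>\<epsilon> = distr \<Omega> borel \<epsilon>"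
    and "\<X> = topological_support P\<^sub>X"
    and "\<Y> = topological_support (distr \<Omega> borel Y)"
    and "\<Y> \<noteq> {}" and "convex \<Y>"
    and "\<Z> \<noteq> {}" and "compact \<Z>"
    and "case_prod c \<in> borel_measurable borel"
    and "cond_expectation_fun \<Omega> Y X fs"
    and "Qs \<in> borel_measurable borel" and "\<forall>u\<in>\<X>. pos_def (Qs u)"
    and "AE p in \<Omega>. Y p = fs (X p) + Qs (X p) *v \<epsilon> p"
    and "integrable \<Omega> \<epsilon>" and "(\<integral>p. \<epsilon> p \<partial>\<Omega>) = 0"
    and "prob_space.indep_set \<Omega> (sets (vimage_algebra (space \<Omega>) \<epsilon> borel))
          (sets (vimage_algebra (space \<Omega>) X borel))"
  \<comment> \<open>true problem\<close>
    and g: "\<And>z u. g z u = true_obj c fs Qs P\<^sub>\<epsilon> z u"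
    and vs: "\<And>u. vs u = opt_value \<Z> (\<lambda>z. g z u)"
    and "\<forall>z\<in>\<Z>. AE u\<in>\<X> in P\<^sub>X. integrable P\<^sub>\<epsilon> (\<lambda>e. c z (fs u + Qs u *v e))"
    and "AE u\<in>\<X> in P\<^sub>X. lsc_on \<Z> (\<lambda>z. g z u)"
  \<comment> \<open>data and full-information SAA\<close>
    and "prob_space M"
    and "\<And>i. x i \<in> borel_measurable M" and "\<And>i. y i \<in> borel_measurable M"
    and "\<forall>i\<ge>1. AE \<omega> in M. x i \<omega> \<in> \<X> \<and> y i \<omega> \<in> \<Y>"
    and D: "\<And>n \<omega>. D n \<omega> = (\<lambda>i\<in>{1..n}. (y i \<omega>, x i \<omega>))"
    and gs: "\<And>n \<omega> z u. gs n \<omega> z u = saa_obj c fs Qs n (D n \<omega>) z u"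
    and "AE u\<in>\<X> in P\<^sub>X. \<forall>i\<ge>1. AE \<omega> in M. fs u + Qs u *v residual fs Qs (y i \<omega>, x i \<omega>) \<in> \<Y>"
  \<comment> \<open>estimates and ER-SAA\<close>
    and "\<And>n. case_prod (fhat n) \<in> borel_measurable (PiM {1..n} (\<lambda>_. borel) \<Otimes>\<^sub>M borel)"
    and "\<And>n. case_prod (Qhat n) \<in> borel_measurable (PiM {1..n} (\<lambda>_. borel) \<Otimes>\<^sub>M borel)"
    and "\<forall>n\<ge>1. AE \<omega> in M. \<forall>u\<in>\<X>. invertible (Qhat n (D n \<omega>) u)"
    and gER: "\<And>n \<omega> z u. gER n \<omega> z u =
          er_obj c \<Y> (fhat n (D n \<omega>)) (Qhat n (D n \<omega>)) n (D n \<omega>) z u"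
    and vER: "\<And>n \<omega> u. vER n \<omega> u = opt_value \<Z> (\<lambda>z. gER n \<omega> z u)"
    and "AE u\<in>\<X> in P\<^sub>X. \<forall>n\<ge>1. (\<lambda>\<omega>. zER n \<omega> u) \<in> borel_measurable M \<and>
          (AE \<omega> in M. is_arg_min (\<lambda>z. gER n \<omega> z u) (\<lambda>z. z \<in> \<Z>) (zER n \<omega> u))"
  \<comment> \<open>(1)\<close>
    and "\<forall>z\<in>\<Z>. \<forall>a\<in>\<Y>. \<forall>b\<in>\<Y>. \<bar>c z b - c z a\<bar> \<le> L z * norm (b - a)"
    and "bdd_above (L ` \<Z>)"
  \<comment> \<open>(2)\<close>
    and "integrable \<Omega> (\<lambda>p. mnorm (Qs (X p)) ^ 4)"
    and "conv_in_prob M (\<lambda>n \<omega>. (1 / real n) * (\<Sum>i=1..n. mnorm (Qs (x i \<omega>)) ^ 4))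
           (\<integral>p. mnorm (Qs (X p)) ^ 4 \<partial>\<Omega>)"
    and "integrable \<Omega> (\<lambda>p. mnorm (matrix_inv (Qs (X p))) ^ 2)"
    and "conv_in_prob M (\<lambda>n \<omega>. (1 / real n) * (\<Sum>i=1..n. mnorm (matrix_inv (Qs (x i \<omega>))) ^ 2))
           (\<integral>p. mnorm (matrix_inv (Qs (X p))) ^ 2 \<partial>\<Omega>)"
  \<comment> \<open>(3)\<close>
    and "integrable \<Omega> (\<lambda>p. norm (\<epsilon> p) ^ 4)"
    and "conv_in_prob M (\<lambda>n \<omega>. (1 / real n) * (\<Sum>i=1..n. norm (residual fs Qs (y i \<omega>, x i \<omega>)) ^ 4))
           (\<integral>p. norm (\<epsilon> p) ^ 4 \<partial>\<Omega>)"
  \<comment> \<open>(4)\<close>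
    and "prob_space N"
    and "AE u\<in>\<X> in P\<^sub>X.
           continuous_on \<Z> (\<lambda>z. g z u) \<and>
           (\<forall>n\<ge>1. AE \<omega> in M. continuous_on \<Z> (\<lambda>z. gs n \<omega> z u)) \<and>
           (\<exists>G. (\<forall>n\<ge>1. AE \<omega> in M. G n \<omega> = (\<lambda>z\<in>\<Z>. sqrt (real n) * (gs n \<omega> z u - g z u))) \<and>
                conv_in_dist (C_space \<Z>) M G N (V u))"
  \<comment> \<open>(5)\<close>
    and "0 < \<alpha>" and "\<alpha> \<le> 1"
    and "AE u\<in>\<X> in P\<^sub>X. bounded_in_prob M (\<lambda>n \<omega>. norm (fhat n (D n \<omega>) u - fs u))
           (\<lambda>n. real n powr (- \<alpha> / 2))"
    and "bounded_in_prob M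
           (\<lambda>n \<omega>. (1 / real n) * (\<Sum>i=1..n. norm (fhat n (D n \<omega>) (x i \<omega>) - fs (x i \<omega>)) ^ 2))
           (\<lambda>n. real n powr (- \<alpha>))"
    and "AE u\<in>\<X> in P\<^sub>X. bounded_in_prob M (\<lambda>n \<omega>. mnorm (Qhat n (D n \<omega>) u - Qs u))
           (\<lambda>n. real n powr (- \<alpha> / 2))"
    and "bounded_in_prob M
           (\<lambda>n \<omega>. (1 / real n) * (\<Sum>i=1..n.
              mnorm (matrix_inv (Qhat n (D n \<omega>) (x i \<omega>)) - matrix_inv (Qs (x i \<omega>))) ^ 2))
           (\<lambda>n. real n powr (- \<alpha>))"
  shows "AE u\<in>\<X> in P\<^sub>X.
           bounded_in_prob M (\<lambda>n \<omega>. \<bar>vER n \<omega> u - vs u\<bar>) (\<lambda>n. real n powr (- \<alpha> / 2)) \<and>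
           bounded_in_prob M (\<lambda>n \<omega>. \<bar>g (zER n \<omega> u) u - vER n \<omega> u\<bar>) (\<lambda>n. real n powr (- \<alpha> / 2))"
proof -
  have \<Y>: "closed \<Y>" "convex \<Y>" "\<Y> \<noteq> {}"
    using assms(8-10) closed_topological_support by auto
  obtain B where B: "0 \<le> B" "\<And>z. z \<in> \<Z> \<Longrightarrow> L z \<le> B"
  proof
    fix z assume "z \<in> \<Z>"
    then show "L z \<le> max 0 (SUP z\<in>\<Z>. L z)"
      using cSUP_upper[OF _ assms(39)] by (meson max.coboundedI2)
  qed simp
  have lip: "\<bar>c z t - c z s\<bar> \<le> B * norm (t - s)" if "z \<in> \<Z>" "s \<in> \<Y>" "t \<in> \<Y>" for z s t
    using assms(38) that B(2)[OF that(1)] by (meson mult_right_mono norm_ge_zero order_trans)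
  \<comment> \<open>At \<open>n = 0\<close> this rate is \<open>0\<close>, since \<open>0 powr t = 0\<close> for every exponent; this is why
    the comparisons of rates below single out that case.\<close>
  let ?a = "\<lambda>n. real n powr (- \<alpha> / 2)"
  have a_nonneg: "0 \<le> ?a n" for n by simp
  have a_le_1: "?a n \<le> 1" for n
    using powr_mono[of "- \<alpha> / 2" 0 "real n"] \<open>0 < \<alpha>\<close> by (cases "n = 0") auto
  have a_square: "real n powr (- \<alpha>) = ?a n * ?a n" for n
    by (simp flip: powr_add)
  have half_le_a: "real n powr (- 1 / 2) \<le> ?a n" for n
    using powr_mono[of "- 1 / 2" "- \<alpha> / 2" "real n"] \<open>\<alpha> \<le> 1\<close> by (cases "n = 0") auto
  define e where "e i \<omega> = norm (residual fs Qs (y i \<omega>, x i \<omega>))" for i \<omega>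
  define \<Delta> where "\<Delta> n i \<omega> =
    mnorm (matrix_inv (Qhat n (D n \<omega>) (x i \<omega>)) - matrix_inv (Qs (x i \<omega>)))" for n i \<omega>
  define \<delta> where "\<delta> n i \<omega> = norm (fhat n (D n \<omega>) (x i \<omega>) - fs (x i \<omega>))" for n i \<omega>
  define T where "T n \<omega> = mean n (\<lambda>i. \<Delta> n i \<omega> ^ 2)" for n \<omega>
  define S where "S n \<omega> = mean n (\<lambda>i. \<delta> n i \<omega> ^ 2)" for n \<omega>
  define I where "I n \<omega> = mean n (\<lambda>i. mnorm (matrix_inv (Qs (x i \<omega>))) ^ 2)" for n \<omega>
  define Q4 where "Q4 n \<omega> = mean n (\<lambda>i. mnorm (Qs (x i \<omega>)) ^ 4)" for n \<omega>
  define E4 where "E4 n \<omega> = mean n (\<lambda>i. e i \<omega> ^ 4)" for n \<omega>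
  have Q4: "bounded_in_prob M Q4 (\<lambda>_. 1)" and I: "bounded_in_prob M I (\<lambda>_. 1)"
    and E4: "bounded_in_prob M E4 (\<lambda>_. 1)"
    using assms(41,43,45)[THEN bounded_in_prob_of_conv_in_prob]
    unfolding Q4_def I_def E4_def e_def by auto
  have S: "bounded_in_prob M (\<lambda>n \<omega>. sqrt (S n \<omega>)) ?a" and T: "bounded_in_prob M (\<lambda>n \<omega>. sqrt (T n \<omega>)) ?a"
    using assms(51,53)[unfolded a_square, THEN bounded_in_prob_sqrt]
    unfolding S_def T_def \<delta>_def \<Delta>_def by auto
  \<comment> \<open>The part of the mean scenario error that comes from the residuals; it does not depend on
    the covariate at which the program is solved.\<close>
  define U where "U n \<omega> = sqrt (T n \<omega>) * sqrt (Q4 n \<omega> + E4 n \<omega>) + sqrt (T n \<omega>) * sqrt (S n \<omega>)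
      + sqrt (I n \<omega>) * sqrt (S n \<omega>)" for n \<omega>
  have "bounded_in_prob M (\<lambda>n \<omega>. sqrt (Q4 n \<omega> + E4 n \<omega>)) (\<lambda>_. 1)"
    and "bounded_in_prob M (\<lambda>n \<omega>. sqrt (I n \<omega>)) (\<lambda>_. 1)"
    using bounded_in_prob_sqrt[OF bounded_in_prob_add[OF Q4 E4]] bounded_in_prob_sqrt[OF I] by auto
  moreover have "bounded_in_prob M (\<lambda>n \<omega>. sqrt (S n \<omega>)) (\<lambda>_. 1)"
    using S a_nonneg a_le_1 by (rule bounded_in_prob_rate_mono)
  ultimately have U: "bounded_in_prob M U ?a"
    unfolding U_def
    using bounded_in_prob_mult[OF T] bounded_in_prob_mult[OF _ S, of _ "\<lambda>_. 1"]
    by (intro bounded_in_prob_add) fastforce+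
  have data: "AE \<omega> in M. \<forall>i\<ge>1. x i \<omega> \<in> \<X>"
    unfolding AE_all_countable using assms(28) by auto
  show ?thesis
    using assms(31,37,47,50,52)
  proof (eventually_elim, intro impI)
    case (elim u)
    assume u: "u \<in> \<X>"
    define F where "F n \<omega> = norm (fhat n (D n \<omega>) u - fs u)" for n \<omega>
    define q where "q n \<omega> = mnorm (Qhat n (D n \<omega>) u - Qs u)" for n \<omega>
    have F: "bounded_in_prob M F ?a" and q: "bounded_in_prob M q ?a"
      using elim(4,5) u unfolding F_def q_def by auto
    obtain G where G: "\<forall>n\<ge>1. AE \<omega> in M. G n \<omega> = (\<lambda>z\<in>\<Z>. sqrt (real n) * (gs n \<omega> z u - g z u))"
        "conv_in_dist (C_space \<Z>) M G N (V u)"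
      using elim(3) u by blast
    obtain W where W: "bounded_in_prob M W (\<lambda>n. real n powr (- 1 / 2))"
      and gs_dev: "\<forall>n\<ge>1. AE \<omega> in M. \<forall>z\<in>\<Z>. \<bar>gs n \<omega> z u - g z u\<bar> \<le> W n \<omega>"
      by (rule bounded_in_prob_uniform_deviation[OF assms(25,46) G(2,1)])
    \<comment> \<open>The bound of \<open>mean_perturbation_le\<close> for the mean scenario error at \<open>u\<close>\<close>
    define R where "R n \<omega> = F n \<omega> + q n \<omega> * (1 + E4 n \<omega>) + (mnorm (Qs u) + q n \<omega>) * U n \<omega>" for n \<omega>
    have "bounded_in_prob M (\<lambda>n \<omega>. q n \<omega> * (1 + E4 n \<omega>)) ?a"
      using bounded_in_prob_mult[OF q bounded_in_prob_add[OF bounded_in_prob_const E4]] by simp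
    moreover have "bounded_in_prob M q (\<lambda>_. 1)"
      using q a_nonneg a_le_1 by (rule bounded_in_prob_rate_mono)
    then have "bounded_in_prob M (\<lambda>n \<omega>. (mnorm (Qs u) + q n \<omega>) * U n \<omega>) ?a"
      using bounded_in_prob_mult[OF bounded_in_prob_add[OF bounded_in_prob_const] U] by simp
    ultimately have R: "bounded_in_prob M R ?a"
      unfolding R_def by (intro bounded_in_prob_add F)
    \<comment> \<open>A bound for the deviation of \<open>gER\<close> from \<open>g\<close>, uniform over the feasible set\<close>
    define \<rho> where "\<rho> n \<omega> = B * R n \<omega> + W n \<omega>" for n \<omega>
    have "bounded_in_prob M (\<lambda>n \<omega>. B * R n \<omega>) ?a"
      using bounded_in_prob_mult[OF bounded_in_prob_const R] by simp
    moreover have "bounded_in_prob M W ?a"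
      using W _ half_le_a by (rule bounded_in_prob_rate_mono) simp
    ultimately have \<rho>: "bounded_in_prob M \<rho> ?a"
      unfolding \<rho>_def by (rule bounded_in_prob_add)
    have scenarios: "AE \<omega> in M. \<forall>i\<ge>1. fs u + Qs u *v residual fs Qs (y i \<omega>, x i \<omega>) \<in> \<Y>"
      unfolding AE_all_countable using elim(1) u by auto
    have main: "AE \<omega> in M. \<bar>vER n \<omega> u - vs u\<bar> \<le> \<rho> n \<omega> \<and> \<bar>g (zER n \<omega> u) u - vER n \<omega> u\<bar> \<le> \<rho> n \<omega>"
      if n: "1 \<le> n" for n
    proof -
      have "AE \<omega> in M. is_arg_min (\<lambda>z. gER n \<omega> z u) (\<lambda>z. z \<in> \<Z>) (zER n \<omega> u)"
        using elim(2) u n by blast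
      then show ?thesis
        using data scenarios gs_dev[rule_format, OF n]
      proof eventually_elim
        case (elim \<omega>)
        have D_i: "D n \<omega> i = (y i \<omega>, x i \<omega>)" if "i \<in> {1..n}" for i
          using that unfolding D by simp
        let ?h = "\<lambda>i. norm ((fhat n (D n \<omega>) u + Qhat n (D n \<omega>) u *v
            residual (fhat n (D n \<omega>)) (Qhat n (D n \<omega>)) (D n \<omega> i))
          - (fs u + Qs u *v residual fs Qs (D n \<omega> i)))"
        have "?h i \<le> F n \<omega> + q n \<omega> * e i \<omega> + (mnorm (Qs u) + q n \<omega>) *
            (\<Delta> n i \<omega> * (mnorm (Qs (x i \<omega>)) * e i \<omega>) + \<Delta> n i \<omega> * \<delta> n i \<omega>
              + mnorm (matrix_inv (Qs (x i \<omega>))) * \<delta> n i \<omega>)" if i: "i \<in> {1..n}" for i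
        proof -
          have inv: "invertible (Qs (x i \<omega>))"
            using elim(2) i assms(16) by (intro invertible_of_pos_def) auto
          show ?thesis
            unfolding D_i[OF i] F_def q_def e_def \<Delta>_def \<delta>_def
            by (rule norm_scenario_diff_le[THEN order_trans])
              (intro add_left_mono mult_left_mono norm_residual_diff_le inv add_nonneg_nonneg mnorm_nonneg)
        qed
        then have h: "mean n ?h \<le> R n \<omega>"
          unfolding R_def U_def T_def S_def I_def Q4_def E4_def
          by (intro mean_perturbation_le[OF n]) (auto simp: q_def \<Delta>_def mnorm_nonneg)
        have "\<bar>gER n \<omega> z u - g z u\<bar> \<le> \<rho> n \<omega>" if z: "z \<in> \<Z>" for z
        proof -
          have "\<bar>gER n \<omega> z u - gs n \<omega> z u\<bar> \<le> B * mean n ?h"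
            unfolding gER gs using elim(3) D_i lip[OF z] by (intro er_obj_saa_obj_diff_le \<Y> B(1)) auto
          also have "\<dots> \<le> B * R n \<omega>"
            using h B(1) by (rule mult_left_mono)
          finally show ?thesis
            using bspec[OF elim(4) z] unfolding \<rho>_def by linarith
        qed
        from opt_value_perturbation[OF elim(1) this] show ?case
          unfolding vER vs by blast
      qed
    qed
    have "AE \<omega> in M. \<bar>\<bar>vER n \<omega> u - vs u\<bar>\<bar> \<le> \<bar>\<rho> n \<omega>\<bar>"
        "AE \<omega> in M. \<bar>\<bar>g (zER n \<omega> u) u - vER n \<omega> u\<bar>\<bar> \<le> \<bar>\<rho> n \<omega>\<bar>" if "1 \<le> n" for n
      using main[OF that] by (auto elim: eventually_mono)
    then have "\<forall>\<^sub>F n in sequentially. AE \<omega> in M. \<bar>\<bar>vER n \<omega> u - vs u\<bar>\<bar> \<le> \<bar>\<rho> n \<omega>\<bar>"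
      and "\<forall>\<^sub>F n in sequentially. AE \<omega> in M. \<bar>\<bar>g (zER n \<omega> u) u - vER n \<omega> u\<bar>\<bar> \<le> \<bar>\<rho> n \<omega>\<bar>"
      unfolding eventually_sequentially by blast+
    then show "bounded_in_prob M (\<lambda>n \<omega>. \<bar>vER n \<omega> u - vs u\<bar>) ?a \<and>
        bounded_in_prob M (\<lambda>n \<omega>. \<bar>g (zER n \<omega> u) u - vER n \<omega> u\<bar>) ?a"
      by (intro conjI bounded_in_prob_mono[OF \<rho>])
  qed
qed

end
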